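(* For a finite loopless matroid $M$ we have $\Upsilon_c(M)=\Upsilon_f(M)=\gamma(M)$.
   Context: Let $M$ have ground set $E$, rank function $r$ and set of bases $\mathcal{B}(M)$. The maximal density is $\gamma(M)=\max_{\varnothing\ne A\subseteq E}|A|/r(A)$. The fractional arboricity $\Upsilon_f(M)$ is the minimum of $\sum_{B\in\mathcal{B}(M)}x(B)$ over all assignments of reals $x(B)\ge 0$ to the bases such that $\sum_{B\ni e}x(B)\ge1$ for every $e\in E$. For $d>0$ let $S_d=\mathbb{R}/d\mathbb{R}$ be the circle of circumference $d$, and for $x\in S_d$ let $[x,x+1)$ denote the cyclic (left-closed, right-open) interval of length $1$ starting at $x$ in the positive direction. The circular arboricity $\Upsilon_c(M)$ is the infimum of all $d$ for which there is a mapping $\phi:E\to S_d$ such that for every $x\in S_d$ the set $\{e\in E\mid \phi(e)\in[x,x+1)\}$ is independent in $M$.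
   Formalization: The ground set is assumed nonempty (otherwise γ(M) is undefined), and the infimum defining Υ_c ranges over d ≥ 1 rather than d > 0, since S_d has no interval of length 1 for d < 1 (wrapping around would give Υ_c = 0 for a matroid with independent ground set, where γ = 1). *)

theory Defs
  imports "HOL-Analysis.Analysis" "HOL-Library.Real_Mod"
begin

section \<open>Finite matroids\<close>

locale matroid =
  fixes E :: "'a set" and indep :: "'a set \<Rightarrow> bool"
  assumes finite_ground: "finite E"
    and indep_subset_ground: "indep I \<Longrightarrow> I \<subseteq> E"
    and indep_empty: "indep {}"
    and indep_subset: "indep I \<Longrightarrow> J \<subseteq> I \<Longrightarrow> indep J"
    and augment: "indep I \<Longrightarrow> indep J \<Longrightarrow> card I < card J \<Longrightarrow> \<exists>e \<in> J - I. indep (insert e I)"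
begin

definition rank :: "'a set \<Rightarrow> nat" where
  "rank A = Max {card I | I. I \<subseteq> A \<and> indep I}"

definition bases :: "'a set set" where
  "bases = {B. indep B \<and> (\<forall>I. indep I \<and> B \<subseteq> I \<longrightarrow> I = B)}"

definition loopless :: bool where
  "loopless \<longleftrightarrow> (\<forall>e \<in> E. indep {e})"

definition max_density :: real where
  "max_density = Max {real (card A) / real (rank A) | A. A \<noteq> {} \<and> A \<subseteq> E}"

text \<open>\<open>LEAST\<close> over the reals denotes an attained minimum; it is unspecified if there is none.\<close>

definition fractional_arboricity :: real where
  "fractional_arboricity =
     (LEAST v. \<exists>x :: 'a set \<Rightarrow> real.
        (\<forall>B \<in> bases. 0 \<le> x B) \<and>
        (\<forall>e \<in> E. 1 \<le> (\<Sum>B \<in> {B \<in> bases. e \<in> B}. x B)) \<and>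
        v = (\<Sum>B \<in> bases. x B))"

end

section \<open>The circle of given circumference\<close>

definition circle_point :: "real \<Rightarrow> real \<Rightarrow> real set" where
  "circle_point d t = {(s, t). [s = t] (rmod d)} `` {t}"

definition circle :: "real \<Rightarrow> real set set" where
  "circle d = UNIV // {(s, t). [s = t] (rmod d)}"

text \<open>
  The interval from \<open>x\<close> to \<open>x + 1\<close> is the projection of the real interval \<open>{t..<t + 1}\<close>, where
  \<open>t\<close> is any representative of \<open>x\<close>. The union below runs over all representatives, which all
  give the same set (see \<open>cyclic_interval_circle_point\<close>).
\<close>

definition cyclic_interval :: "real \<Rightarrow> real set \<Rightarrow> real set set" where
  "cyclic_interval d x = (\<Union>t \<in> x. circle_point d ` {t..<t + 1})"

lemma circle_point_eq_iff: "circle_point d s = circle_point d t \<longleftrightarrow> [s = t] (rmod d)"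
  by (auto simp: circle_point_def rcong_def)

lemma circle_eq_range: "circle d = range (circle_point d)"
  by (auto simp: circle_def quotient_def circle_point_def)

lemma cyclic_interval_circle_point:
  "cyclic_interval d (circle_point d t) = circle_point d ` {t..<t + 1}"
proof -
  have "circle_point d ` {s..<s + 1} \<subseteq> circle_point d ` {t..<t + 1}" if "[t = s] (rmod d)" for s
  proof
    fix p assume "p \<in> circle_point d ` {s..<s + 1}"
    then obtain u where u: "p = circle_point d u" "s \<le> u" "u < s + 1" by auto
    have "[t + (u - s) = s + (u - s)] (rmod d)"
      using that by (intro rcong_add) auto
    then have "p = circle_point d (t + (u - s))"
      using u by (simp add: circle_point_eq_iff rcong_sym_iff)
    then show "p \<in> circle_point d ` {t..<t + 1}"
      using u by (intro image_eqI[of _ _ "t + (u - s)"]) auto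
  qed
  moreover have "t \<in> circle_point d t"
    by (simp add: circle_point_def)
  ultimately show ?thesis
    unfolding cyclic_interval_def by (auto simp: circle_point_def)
qed

text \<open>
  The condition \<open>1 \<le> d\<close> says that the circle is long enough to contain an interval of length
  \<open>1\<close>. On a shorter circle the projection of \<open>{t..<t + 1}\<close> would overlap itself and be the whole
  circle; admitting such \<open>d\<close> would give a matroid whose ground set is independent circular
  arboricity \<open>0\<close>, although its density is \<open>1\<close>.
\<close>

definition (in matroid) circular_arboricity :: real where
  "circular_arboricity =
     Inf {d. 1 \<le> d \<and> (\<exists>\<phi> \<in> E \<rightarrow> circle d.
            \<forall>x \<in> circle d. indep {e \<in> E. \<phi> e \<in> cyclic_interval d x})}"

end

theory Submission
  imports Defs "HOL-Number_Theory.Cong"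
begin

text \<open>
  Both arboricities dominate the density by double counting (integration over the circle, for the
  circular one). Conversely, let the density be \<open>p / q\<close>. It suffices to assign to every element
  a cyclic interval of \<open>q\<close> residues modulo \<open>p\<close> such that the elements whose intervals contain a
  given residue are always independent: these \<open>p\<close> independent sets give a fractional cover, and
  the left end points, divided by \<open>q\<close>, give a map to the circle of circumference \<open>p / q\<close>.

  Such an assignment, for arbitrary lengths \<open>w e\<close> with \<open>w(A) \<le> N r(A)\<close>, is built by lengthening
  one interval at a time. If the interval of \<open>a\<close> is one
  short and extending it to its right end \<open>z\<close> closes a circuit \<open>C\<close> there, then some member of \<open>C\<close>
  has its interval starting at \<open>z\<close>; extend \<open>a\<close>, cut off the first residue of the member \<open>b\<close> that
  has been moved least, and go on with \<open>b\<close> as the short element. These exchanges never change the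
  span at a residue. If they went on forever, the elements that move infinitely often, together with
  the fixed elements that keep occurring in the circuits, would be spanned by their own members at
  every residue, and counting would give \<open>N r(H) \<le> w(H) - 1\<close>.
\<close>

section \<open>Span and circuits\<close>

context matroid
begin

section \<open>Rank and maximal independent subsets\<close>

lemma indep_finite: "indep I \<Longrightarrow> finite I"
  using finite_ground indep_subset_ground finite_subset by blast

lemma finite_indep_cards: "finite {card I | I. I \<subseteq> A \<and> indep I}"
proof -
  have "{card I | I. I \<subseteq> A \<and> indep I} \<subseteq> card ` Pow E"
    using indep_subset_ground by auto
  then show ?thesis
    using finite_ground by (meson finite_Pow_iff finite_imageI finite_subset)
qed

lemma card_le_rank: "indep I \<Longrightarrow> I \<subseteq> A \<Longrightarrow> card I \<le> rank A"
  unfolding rank_def using finite_indep_cards by (intro Max_ge) auto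

lemma rank_le:
  assumes "\<And>I. indep I \<Longrightarrow> I \<subseteq> A \<Longrightarrow> card I \<le> k"
  shows "rank A \<le> k"
  unfolding rank_def using assms indep_empty
  by (subst Max_le_iff[OF finite_indep_cards]) auto

lemma rank_singleton_le: "rank {e} \<le> 1"
  using card_mono[of "{e}"] by (intro rank_le) auto

lemma extend_maximal:
  assumes "indep I" "I \<subseteq> X"
  obtains J where "indep J" "I \<subseteq> J" "J \<subseteq> X" "\<And>e. e \<in> X \<Longrightarrow> indep (insert e J) \<Longrightarrow> e \<in> J"
proof -
  let ?S = "{J. indep J \<and> I \<subseteq> J \<and> J \<subseteq> X}"
  have "?S \<subseteq> Pow E"
    using indep_subset_ground by auto
  then have "finite ?S"
    using finite_ground by (meson finite_Pow_iff finite_subset)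
  moreover have "?S \<noteq> {}"
    using assms by auto
  ultimately obtain J where J: "J \<in> ?S" "\<forall>K \<in> ?S. J \<subseteq> K \<longrightarrow> J = K"
    by (rule finite_has_maximal[THEN bexE])
  show thesis
  proof (rule that)
    fix e assume "e \<in> X" "indep (insert e J)"
    then have "insert e J \<in> ?S"
      using J(1) by auto
    then show "e \<in> J"
      using J(2) by blast
  qed (use J in auto)
qed

section \<open>Closure and circuits\<close>

definition span :: "'a set \<Rightarrow> 'a set" where
  "span X = {e \<in> E. e \<in> X \<or> (\<exists>I \<subseteq> X. indep I \<and> \<not> indep (insert e I))}"

lemma span_superset: "X \<subseteq> E \<Longrightarrow> X \<subseteq> span X"
  by (auto simp: span_def)

lemma span_mono: "X \<subseteq> Y \<Longrightarrow> span X \<subseteq> span Y"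
  unfolding span_def by blast

text \<open>A witness \<open>I\<close> for \<open>e\<close> extends to a maximal independent
  \<open>K\<close> in \<open>X\<close>, and \<open>card K <= card J\<close>. If \<open>e\<close>
  were new to \<open>J\<close>, augmenting \<open>K\<close> from \<open>insert e J\<close> would add
  \<open>e\<close>, against the witness, or an element of \<open>X\<close>, against maximality of
  \<open>K\<close>.\<close>

lemma span_maximal:
  assumes J: "indep J" "J \<subseteq> X" "\<And>g. g \<in> X \<Longrightarrow> indep (insert g J) \<Longrightarrow> g \<in> J"
    and "e \<in> span X" "indep (insert e J)"
  shows "e \<in> J"
proof (cases "e \<in> X")
  case True
  then show ?thesis using assms by blast
next
  case False
  then obtain I where I: "I \<subseteq> X" "indep I" "\<not> indep (insert e I)"
    using assms by (auto simp: span_def)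
  obtain K where K: "indep K" "I \<subseteq> K" "K \<subseteq> X" "\<And>e. e \<in> X \<Longrightarrow> indep (insert e K) \<Longrightarrow> e \<in> K"
    using extend_maximal[OF I(2,1)] by metis
  have "card K \<le> card J"
    using augment[OF J(1) K(1)] J(3) K(3) by (meson DiffD1 DiffD2 leI subsetD)
  moreover have "finite J"
    using J indep_finite by auto
  ultimately have *: "card K < card (insert e J)" if "e \<notin> J"
    using that by simp
  show ?thesis
  proof (rule ccontr)
    assume "e \<notin> J"
    then obtain g where g: "g \<in> insert e J - K" "indep (insert g K)"
      using augment[OF K(1) assms(5)] * by blast
    show False
    proof (cases "g = e")
      case True
      then show ?thesis
        using g I K indep_subset[of "insert e K" "insert e I"] by blast
    next
      case False
      then show ?thesis
        using g J K by blast
    qed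
  qed
qed

text \<open>Two uses of \<open>span_maximal\<close>: the first shows that a maximal independent
  \<open>J\<close> in \<open>X\<close> is still maximal in \<open>X \<union> Y\<close>, the second
  that nothing in \<open>span Y\<close> enlarges it.\<close>

lemma span_subset_span:
  assumes "Y \<subseteq> span X"
  shows "span Y \<subseteq> span X"
proof
  fix e assume e: "e \<in> span Y"
  obtain J where J: "indep J" "J \<subseteq> X" "\<And>e. e \<in> X \<Longrightarrow> indep (insert e J) \<Longrightarrow> e \<in> J"
    using extend_maximal[OF indep_empty empty_subsetI, of X] by metis
  have "e \<in> span (X \<union> Y)"
    using e span_mono[of Y "X \<union> Y"] by blast
  moreover have "g \<in> J" if "g \<in> X \<union> Y" "indep (insert g J)" for g
    using that J assms span_maximal[OF J, of g] by blast
  ultimately have "e \<in> J \<or> \<not> indep (insert e J)"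
    using span_maximal[OF J(1), of "X \<union> Y" e] J(2) by blast
  moreover have "e \<in> E"
    using e by (auto simp: span_def)
  ultimately show "e \<in> span X"
    using J by (auto simp: span_def)
qed

lemma indep_not_in_span:
  assumes "indep I" "e \<in> I"
  shows "e \<notin> span (I - {e})"
proof -
  have "indep (insert e K)" if "K \<subseteq> I - {e}" for K
    using that assms by (intro indep_subset[OF assms(1)]) auto
  then show ?thesis
    by (auto simp: span_def)
qed

lemma rank_le_card_spanning:
  assumes "indep I" "A \<subseteq> span I"
  shows "rank A \<le> card I"
proof (rule rank_le)
  fix J assume J: "indep J" "J \<subseteq> A"
  show "card J \<le> card I"
  proof (rule ccontr)
    assume "\<not> card J \<le> card I"
    then obtain e where "e \<in> J - I" "indep (insert e I)"
      using augment[OF assms(1) J(1)] by auto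
    then show False
      using span_maximal[OF assms(1), of I e] assms J by auto
  qed
qed

definition circuit :: "'a set \<Rightarrow> bool" where
  "circuit C \<longleftrightarrow> C \<subseteq> E \<and> \<not> indep C \<and> (\<forall>e \<in> C. indep (C - {e}))"

lemma circuit_in_span:
  assumes "circuit C" "e \<in> C"
  shows "e \<in> span (C - {e})"
proof -
  have "indep (C - {e})" "\<not> indep (insert e (C - {e}))" "e \<in> E"
    using assms by (auto simp: circuit_def insert_absorb)
  then show ?thesis
    unfolding span_def by blast
qed

lemma dependent_contains_circuit:
  assumes "X \<subseteq> E" "\<not> indep X"
  obtains C where "circuit C" "C \<subseteq> X"
proof -
  let ?S = "{C. C \<subseteq> X \<and> \<not> indep C}"
  have "finite ?S"
    using finite_ground assms by (auto intro: finite_subset[of _ "Pow E"])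
  moreover have "?S \<noteq> {}"
    using assms by auto
  ultimately obtain C where C: "C \<in> ?S" "\<forall>K \<in> ?S. K \<subseteq> C \<longrightarrow> C = K"
    by (rule finite_has_minimal[THEN bexE])
  have "indep (C - {e})" if "e \<in> C" for e
  proof (rule ccontr)
    assume "\<not> indep (C - {e})"
    then have "C - {e} \<in> ?S" using C(1) by auto
    then show False using C(2) that by blast
  qed
  then show thesis
    using that[of C] C(1) assms by (auto simp: circuit_def)
qed

text \<open>Were the result dependent, \<open>a\<close> would be spanned by \<open>D - {b}\<close>,
  hence so would \<open>C - {b}\<close> and, through the circuit, \<open>b\<close> itself, against
  independence of \<open>D\<close>.\<close>

lemma circuit_exchange:
  assumes "indep D" "circuit C" "C \<subseteq> insert a D" "b \<in> C"
  shows "indep (insert a D - {b})"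
proof (cases "b = a \<or> b \<notin> D")
  case True
  then show ?thesis
    using assms indep_subset[OF assms(1)] by (metis Diff_insert_absorb Diff_subset insertE insert_absorb subsetD)
next
  case False
  have "a \<in> C"
    using assms indep_subset[of D C] by (auto simp: circuit_def)
  then have "a \<in> E"
    using assms by (auto simp: circuit_def)
  have sub: "D - {b} \<subseteq> E"
    using assms indep_subset_ground by auto
  show ?thesis
  proof (rule ccontr)
    assume dep: "\<not> ?thesis"
    have "indep (D - {b})"
      using assms indep_subset by blast
    then have "a \<in> span (D - {b})"
      using dep False \<open>a \<in> E\<close> by (auto simp: span_def insert_Diff_if)
    then have "C - {b} \<subseteq> span (D - {b})"
      using assms(3) span_superset[OF sub] by auto
    then have "b \<in> span (D - {b})"
      using span_subset_span circuit_in_span[OF assms(2,4)] by blast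
    then show False
      using indep_not_in_span[OF assms(1)] False by auto
  qed
qed

end

section \<open>Cyclic intervals\<close>

lemma cong_window_unique:
  fixes s :: nat
  assumes "[s + j = s + k] (mod N)" "j < l" "k < l" "l \<le> N"
  shows "j = k"
proof -
  have "[j = k] (mod N)"
    using assms(1) by (simp add: cong_add_lcancel_nat)
  then show ?thesis
    using assms by (intro cong_less_modulus_unique_nat[of j k N]) auto
qed

context matroid
begin

text \<open>\<open>load N w s y\<close> is the set of elements whose cyclic interval of length \<open>w e\<close> starting at \<open>s e\<close>
  contains \<open>y\<close>. Start points are natural numbers rather than residues, so that they also record how
  far an element has been pushed.\<close>

definition load :: "nat \<Rightarrow> ('a \<Rightarrow> nat) \<Rightarrow> ('a \<Rightarrow> nat) \<Rightarrow> nat \<Rightarrow> 'a set" where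
  "load N w s y = {e \<in> E. \<exists>k < w e. [s e + k = y] (mod N)}"

lemma load_cong: "[y = z] (mod N) \<Longrightarrow> load N w s y = load N w s z"
  unfolding load_def by (meson cong_sym cong_trans)

text \<open>Since \<open>w a <= N\<close>, the interval meets its last residue only once, so
  shortening really uncovers it.\<close>

lemma load_shorten_right:
  assumes "0 < w a" "w a \<le> N"
  shows "load N (w(a := w a - 1)) s y =
    (if [y = s a + (w a - 1)] (mod N) then load N w s y - {a} else load N w s y)"
proof -
  have "(\<exists>k < w a - 1. [s a + k = y] (mod N)) \<longleftrightarrow>
    \<not> [y = s a + (w a - 1)] (mod N) \<and> (\<exists>k < w a. [s a + k = y] (mod N))" (is "?L = ?R")
  proof
    assume ?L
    then obtain k where k: "k < w a - 1" "[s a + k = y] (mod N)" by blast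
    have "\<not> [y = s a + (w a - 1)] (mod N)"
    proof
      assume "[y = s a + (w a - 1)] (mod N)"
      then have "[s a + k = s a + (w a - 1)] (mod N)"
        using k cong_trans by blast
      then have "k = w a - 1"
        by (rule cong_window_unique[where l = "w a"]) (use k assms in auto)
      then show False using k by simp
    qed
    then show ?R using k by (metis order_less_le_trans diff_le_self)
  next
    assume R: ?R
    then obtain k where k: "k < w a" "[s a + k = y] (mod N)" by blast
    have "k \<noteq> w a - 1"
      using R k cong_sym by blast
    then have "k < w a - 1" using k by linarith
    then show ?L using k by blast
  qed
  then show ?thesis
    by (auto simp: load_def split: if_splits)
qed

text \<open>Cutting off the first residue of \<open>b\<close> amounts to moving \<open>b\<close> by
  one and letting it lack its last residue, which is how the next short element is recorded.\<close>

lemma load_shift: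
  assumes "0 < w b" "w b \<le> N"
  shows "load N (w(b := w b - 1)) (s(b := Suc (s b))) y =
    (if [y = s b] (mod N) then load N w s y - {b} else load N w s y)"
proof -
  have "(\<exists>k < w b - 1. [Suc (s b) + k = y] (mod N)) \<longleftrightarrow>
    \<not> [y = s b] (mod N) \<and> (\<exists>k < w b. [s b + k = y] (mod N))" (is "?L = ?R")
  proof
    assume ?L
    then obtain k where k: "k < w b - 1" "[s b + Suc k = y] (mod N)" by auto
    have "\<not> [y = s b] (mod N)"
    proof
      assume "[y = s b] (mod N)"
      then have "[s b + Suc k = s b + 0] (mod N)"
        using k cong_trans by fastforce
      then have "Suc k = 0"
        by (rule cong_window_unique[where l = "w b"]) (use k assms in auto)
      then show False by simp
    qed
    moreover have "Suc k < w b" using k by linarith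
    ultimately show ?R using k by blast
  next
    assume R: ?R
    then obtain k where k: "k < w b" "[s b + k = y] (mod N)" by blast
    have "k \<noteq> 0"
      using R k cong_sym by (metis add_0_right)
    then obtain j where "k = Suc j" by (cases k) auto
    then have "j < w b - 1" "[Suc (s b) + j = y] (mod N)" using k by auto
    then show ?L by blast
  qed
  then show ?thesis
    by (auto simp: load_def split: if_splits)
qed

text \<open>Double counting of pairs of an element and a residue: a length of at most
  \<open>N\<close> covers as many distinct residues as it has steps.\<close>

lemma sum_card_load:
  assumes "G \<subseteq> E" "\<And>e. e \<in> G \<Longrightarrow> w e \<le> N" "0 < N"
  shows "(\<Sum>y<N. card (G \<inter> load N w s y)) = sum w G"
proof -
  have fin: "finite G"
    using assms finite_ground finite_subset by blast
  have "(\<Sum>y<N. card (G \<inter> load N w s y)) = (\<Sum>y<N. card {e \<in> G. e \<in> load N w s y})"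
    by (simp add: Int_def)
  also have "\<dots> = (\<Sum>e\<in>G. card {y \<in> {..<N}. e \<in> load N w s y})"
    by (rule sum_multicount_gen[symmetric]) (use fin in auto)
  also have "\<dots> = sum w G"
  proof (rule sum.cong)
    fix e assume e: "e \<in> G"
    have "{y \<in> {..<N}. e \<in> load N w s y} = (\<lambda>k. (s e + k) mod N) ` {..<w e}"
      using e assms by (force simp: load_def cong_def)
    moreover have "inj_on (\<lambda>k. (s e + k) mod N) {..<w e}"
      using cong_window_unique[OF _ _ _ assms(2)[OF e]]
      unfolding inj_on_def cong_def by blast
    ultimately show "card {y \<in> {..<N}. e \<in> load N w s y} = w e"
      by (simp add: card_image)
  qed simp
  finally show ?thesis .
qed

end

text \<open>An infinite run of the exchange process: at step \<open>n\<close> the interval of \<open>short n\<close> lacks its last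
  residue. The axiom on least start points makes the process prefer elements that lag behind.\<close>

locale push_sequence = matroid E indep for E :: "'a set" and indep +
  fixes N :: nat and w :: "'a \<Rightarrow> nat"
    and start :: "nat \<Rightarrow> 'a \<Rightarrow> nat" and short :: "nat \<Rightarrow> 'a" and C :: "nat \<Rightarrow> 'a set"
  assumes N_pos: "0 < N"
    and weight_le: "A \<subseteq> E \<Longrightarrow> sum w A \<le> N * rank A"
    and short_ground: "short n \<in> E"
    and short_weight: "0 < w (short n)"
    and indep_load: "indep (load N (w(short n := w (short n) - 1)) (start n) y)"
    and circuit: "circuit (C n)"
    and circuit_load: "C n \<subseteq> load N w (start n) (start n (short n) + (w (short n) - 1))"
    and short_Suc_circuit: "short (Suc n) \<in> C n"
    and short_Suc_start: "[start n (short (Suc n)) = start n (short n) + (w (short n) - 1)] (mod N)"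
    and short_Suc_least: "e \<in> C n \<Longrightarrow> [start n e = start n (short n) + (w (short n) - 1)] (mod N)
      \<Longrightarrow> start n (short (Suc n)) \<le> start n e"
    and start_Suc: "start (Suc n) = (start n)(short (Suc n) := Suc (start n (short (Suc n))))"
begin

lemma weight_le_N: "e \<in> E \<Longrightarrow> w e \<le> N"
proof -
  assume "e \<in> E"
  then show ?thesis
    using weight_le[of "{e}"] rank_singleton_le[of e] by (auto intro: order_trans[of _ "N * rank {e}"])
qed

section \<open>Loads along a run\<close>

definition stop :: "nat \<Rightarrow> nat" where
  "stop n = start n (short n) + (w (short n) - 1)"

text \<open>The independent sets maintained by the run, with the short element one residue
  short.\<close>

definition part :: "nat \<Rightarrow> nat \<Rightarrow> 'a set" where
  "part n y = load N (w(short n := w (short n) - 1)) (start n) y"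

lemma part_eq:
  "part n y = (if [y = stop n] (mod N) then load N w (start n) y - {short n} else load N w (start n) y)"
  unfolding part_def stop_def
  by (rule load_shorten_right) (auto simp: short_weight short_ground weight_le_N)

text \<open>The next short element starts at \<open>stop n\<close>, so consecutive parts come from
  the same full load and differ only there: one omits \<open>short n\<close>, the other
  \<open>short (Suc n)\<close>.\<close>

lemma part_Suc:
  "part (Suc n) y =
    (if [y = stop n] (mod N) then load N w (start n) y - {short (Suc n)} else load N w (start n) y)"
proof -
  have "part (Suc n) y = (if [y = start n (short (Suc n))] (mod N)
    then load N w (start n) y - {short (Suc n)} else load N w (start n) y)"
    unfolding part_def start_Suc
    using load_shift[of w "short (Suc n)" N "start n" y] by (simp add: short_weight short_ground weight_le_N)
  moreover have "[y = start n (short (Suc n))] (mod N) \<longleftrightarrow> [y = stop n] (mod N)"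
    using short_Suc_start[of n] unfolding stop_def by (meson cong_sym cong_trans)
  ultimately show ?thesis by simp
qed

lemma indep_part: "indep (part n y)"
  unfolding part_def by (rule indep_load)

lemma circuit_subset_part: "C n \<subseteq> insert (short n) (part n (stop n))"
  using circuit_load[of n] by (auto simp: part_eq stop_def)

lemma short_in_circuit: "short n \<in> C n"
  using circuit_subset_part[of n] indep_part[of n "stop n"] circuit[of n] indep_subset
  unfolding circuit_def by blast

lemma start_mono: "m \<le> n \<Longrightarrow> start m e \<le> start n e"
  by (rule lift_Suc_mono_le[of "\<lambda>n. start n e"]) (auto simp: start_Suc)

section \<open>Elements pushed infinitely often\<close>

definition movers :: "'a set" where
  "movers = {e. \<exists>\<^sub>F n in sequentially. short n = e}"

lemma movers_ground: "movers \<subseteq> E"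
  unfolding movers_def using short_ground by (auto dest!: frequently_ex)

lemma start_unbounded:
  assumes "e \<in> movers"
  shows "\<exists>n. v \<le> start n e"
proof (induction v)
  case (Suc v)
  then obtain n where n: "v \<le> start n e" by blast
  \<comment> \<open>\<open>short m\<close> is moved on the way into step \<open>m\<close>, so the
    occurrence must come strictly after \<open>n\<close>.\<close>
  have "\<exists>m \<ge> Suc n. short m = e"
    using assms by (simp add: movers_def frequently_sequentially)
  then obtain m where "n < m" "short m = e"
    using Suc_le_eq by blast
  then obtain k where "n \<le> k" "short (Suc k) = e"
    using gr0_implies_Suc less_Suc_eq_le by (metis gr_implies_not0 not_gr_zero)
  then show ?case
    using n start_mono[of n k e] by (intro exI[of _ "Suc k"]) (auto simp: start_Suc)
qed simp

text \<open>Start points grow by at most one per step, so a mover takes every later value; when it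
  first reaches \<open>v\<close> it has just been moved and is therefore short.\<close>

lemma start_hits:
  assumes "e \<in> movers" "start m e < v"
  obtains n where "m \<le> n" "short n = e" "start n e = v"
proof -
  define P where "P = (\<lambda>n. v \<le> start n e)"
  define n where "n = (LEAST n. P n)"
  have Pn: "P n"
    unfolding n_def using start_unbounded[OF assms(1), of v] by (metis P_def LeastI)
  have "m < n"
    using Pn assms(2) start_mono[of n m e] unfolding P_def by (meson leI le_less_trans order.strict_trans1 less_irrefl)
  then obtain k where k: "n = Suc k" "m \<le> k"
    by (cases n) auto
  have "\<not> P k"
    using not_less_Least[of k P] k unfolding n_def[symmetric] by simp
  then have "short n = e \<and> start n e = v"
    using Pn unfolding P_def k start_Suc by (auto split: if_splits)
  then show thesis
    using that[of n] k by auto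
qed

lemma movers_eventually_ahead:
  obtains n where "\<And>m. n \<le> m \<Longrightarrow> short m \<in> movers"
    and "\<And>m e f. n \<le> m \<Longrightarrow> e \<in> movers \<Longrightarrow> f \<in> E - movers \<Longrightarrow> start m f < start m e"
    and "\<And>m f. n \<le> m \<Longrightarrow> f \<in> E - movers \<Longrightarrow> start m f = start n f"
proof -
  have "\<forall>\<^sub>F n in sequentially. \<forall>e \<in> E - movers. short n \<noteq> e"
    using finite_ground by (subst eventually_ball_finite_distrib) (auto simp: movers_def frequently_def)
  then obtain n0 where n0: "\<And>n. n \<ge> n0 \<Longrightarrow> short n \<in> movers"
    unfolding eventually_sequentially using short_ground by blast
  have const: "start m f = start n f" if "n0 \<le> n" "n \<le> m" "f \<in> E - movers" for m n f
    using that(2)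
  proof (induction m rule: dec_induct)
    case (step k)
    then have "short (Suc k) \<noteq> f"
      using n0[of "Suc k"] that by auto
    then show ?case using step by (simp add: start_Suc)
  qed simp
  define v where "v = Suc (\<Sum>f\<in>E. start n0 f)"
  have "\<forall>\<^sub>F n in sequentially. \<forall>e \<in> movers. v \<le> start n e"
    using finite_subset[OF movers_ground finite_ground]
  proof (rule eventually_ball_finite, intro ballI)
    fix e assume "e \<in> movers"
    then obtain n where "v \<le> start n e" using start_unbounded by blast
    then show "\<forall>\<^sub>F n in sequentially. v \<le> start n e"
      unfolding eventually_sequentially using start_mono order_trans by meson
  qed
  then obtain n1 where n1: "\<And>n e. n1 \<le> n \<Longrightarrow> e \<in> movers \<Longrightarrow> v \<le> start n e"
    unfolding eventually_sequentially by blast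
  show thesis
  proof (rule that[of "max n0 n1"])
    fix m e f assume m: "max n0 n1 \<le> m" "e \<in> movers" "f \<in> E - movers"
    have "start m f = start n0 f"
      using const[of n0 m f] m by auto
    also have "\<dots> \<le> (\<Sum>f\<in>E. start n0 f)"
      using finite_ground m by (intro member_le_sum) auto
    also have "\<dots> < start m e"
      using n1[of m e] m unfolding v_def by auto
    finally show "start m f < start m e" .
  qed (use n0 const in auto)
qed

theorem push_sequence_impossible: False
proof -
  obtain n0 where short_mover: "\<And>n. n0 \<le> n \<Longrightarrow> short n \<in> movers"
    and ahead: "\<And>n e f. n0 \<le> n \<Longrightarrow> e \<in> movers \<Longrightarrow> f \<in> E - movers \<Longrightarrow> start n f < start n e"
    and const: "\<And>n f. n0 \<le> n \<Longrightarrow> f \<in> E - movers \<Longrightarrow> start n f = start n0 f"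
    using movers_eventually_ahead by blast
  \<comment> \<open>\<open>R y\<close> collects the fixed elements at \<open>y\<close>, constant in
    time from \<open>n0\<close> on; \<open>Q y\<close> keeps those occurring in circuits closed at
    \<open>y\<close>; \<open>G n y\<close> adds the movers currently present.\<close>
  define R where "R y = load N w (start n0) y - movers" for y
  define Q where "Q y = (\<Union>n \<in> {n. n0 \<le> n \<and> [stop n = y] (mod N)}. C n - movers)" for y
  define G where "G n y = movers \<inter> part n y \<union> Q y" for n y

  have load_R: "load N w (start n) y - movers = R y" if "n0 \<le> n" for n y
    using const[OF that] by (auto simp: R_def load_def)
  have R_part: "R y \<subseteq> part n y" if "n0 \<le> n" for n y
    using load_R[OF that] short_mover[OF that] by (auto simp: part_eq)
  have Q_R: "Q y \<subseteq> R y" for y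
  proof
    fix f assume "f \<in> Q y"
    then obtain n where n: "n0 \<le> n" "[stop n = y] (mod N)" "f \<in> C n - movers"
      by (auto simp: Q_def)
    then show "f \<in> R y"
      using circuit_load[of n] load_cong[OF n(2)] load_R[of n y] unfolding stop_def by blast
  qed
  \<comment> \<open>A fixed element starting at the stop point would lie behind all movers and be pushed instead.\<close>
  have Q_Suc_R: "Q (Suc y) \<subseteq> R y" for y
  proof
    fix f assume "f \<in> Q (Suc y)"
    then obtain n where n: "n0 \<le> n" "[stop n = Suc y] (mod N)" "f \<in> C n - movers"
      by (auto simp: Q_def)
    then have "f \<in> load N w (start n) (Suc y)"
      using circuit_load[of n] load_cong[OF n(2)] unfolding stop_def by blast
    then obtain k where k: "f \<in> E" "k < w f" "[start n f + k = Suc y] (mod N)"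
      by (auto simp: load_def)
    have "k \<noteq> 0"
    proof
      assume "k = 0"
      then have "[start n f = stop n] (mod N)"
        using k n by (metis add_0_right cong_sym cong_trans)
      then have "start n (short (Suc n)) \<le> start n f"
        using short_Suc_least n unfolding stop_def by blast
      moreover have "start n f < start n (short (Suc n))"
        using ahead n short_mover[of "Suc n"] k by auto
      ultimately show False by simp
    qed
    then obtain j where "k = Suc j" by (cases k) auto
    then have "[start n f + j = y] (mod N)"
      using k cong_add_rcancel_nat[of "start n f + j" 1 y N] by simp
    then have "f \<in> load N w (start n) y"
      using k \<open>k = Suc j\<close> by (auto simp: load_def intro!: exI[of _ j])
    then show "f \<in> R y"
      using load_R n by blast
  qed

  have G_ground: "G n y \<subseteq> E" for n y
    using movers_ground Q_R by (auto simp: G_def R_def load_def)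
  have circuit_G: "C n - {short n} \<subseteq> G n y" if "n0 \<le> n" "[stop n = y] (mod N)" for n y
  proof -
    have "part n (stop n) = part n y"
      using that(2) unfolding part_def by (rule load_cong)
    then show ?thesis
      using circuit_subset_part[of n] that by (auto simp: G_def Q_def)
  qed
  have short_span: "short n \<in> span (G n y)" if "n0 \<le> n" "[stop n = y] (mod N)" for n y
    using circuit_in_span[OF circuit short_in_circuit] span_mono[OF circuit_G[OF that]] by blast
  \<comment> \<open>At the stop residue the only possible newcomer is \<open>short n\<close>, which
    the circuit places in the span of \<open>G n y\<close>. Spans thus never grow, so membership at
    a later time carries back to \<open>n0\<close>.\<close>
  have G_Suc: "G (Suc n) y \<subseteq> span (G n y)" if "n0 \<le> n" for n y
  proof (cases "[y = stop n] (mod N)")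
    case True
    then have "G (Suc n) y \<subseteq> insert (short n) (G n y)"
      by (auto simp: G_def part_eq[of n] part_Suc)
    then show ?thesis
      using short_span[OF that cong_sym[OF True]] span_superset[OF G_ground[of n y]] by blast
  next
    case False
    then have "G (Suc n) y = G n y"
      by (auto simp: G_def part_eq[of n] part_Suc)
    then show ?thesis
      using span_superset[OF G_ground[of n y]] by simp
  qed
  have span_G: "span (G n y) \<subseteq> span (G m y)" if "n0 \<le> m" "m \<le> n" for m n y
    using that(2)
  proof (induction n rule: dec_induct)
    case (step k)
    then show ?case
      using span_subset_span[OF G_Suc[of k y]] that by auto
  qed simp
  \<comment> \<open>Every mover is at some later time short exactly at the residue \<open>y\<close>,
    and is spanned there by the rest of its circuit.\<close>
  have movers_span: "movers \<subseteq> span (G n0 y)" for y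
  proof
    fix e assume e: "e \<in> movers"
    obtain m where "short m = e"
      using start_hits[OF e lessI] by metis
    then have "0 < w e"
      using short_weight by blast
    \<comment> \<open>A start point whose interval ends at the residue \<open>y\<close>; the
      multiple of \<open>N\<close> is large enough to pass \<open>start n0 e\<close> and to avoid
      truncated subtraction.\<close>
    define v where "v = y + N * (start n0 e + w e + 1) - (w e - 1)"
    have le: "start n0 e + w e + 1 \<le> N * (start n0 e + w e + 1)"
      using N_pos by (cases N) auto
    then have "start n0 e < v"
      unfolding v_def by linarith
    then obtain n where n: "n0 \<le> n" "short n = e" "start n e = v"
      using start_hits[OF e] by metis
    have "v + (w e - 1) = y + N * (start n0 e + w e + 1)"
      unfolding v_def using le by linarith
    then have "[stop n = y] (mod N)"
      unfolding stop_def n cong_def by (metis mod_mult_self2)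
    then show "e \<in> span (G n0 y)"
      using short_span[of n y] span_G[of n0 n y] n by auto
  qed

  \<comment> \<open>Hence \<open>Q y\<close> does not depend on \<open>y\<close>, by periodicity.\<close>
  have Q_Suc: "Q (Suc y) \<subseteq> Q y" for y
  proof
    fix f assume f: "f \<in> Q (Suc y)"
    show "f \<in> Q y"
    proof (rule ccontr)
      assume "f \<notin> Q y"
      \<comment> \<open>Without \<open>f\<close> in \<open>Q y\<close>, the set
        \<open>G n0 y\<close> avoids \<open>f\<close> and still spans all movers. The fixed members
        of the circuit lie in \<open>part n0 y\<close>, so the rest of the circuit, and hence
        \<open>f\<close>, is spanned by \<open>part n0 y\<close> without \<open>f\<close>.\<close>
      let ?D = "part n0 y - {f}"
      have D_ground: "?D \<subseteq> E"
        using indep_part indep_subset_ground by blast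
      obtain n where n: "n0 \<le> n" "[stop n = Suc y] (mod N)" "f \<in> C n" "f \<notin> movers"
        using f by (auto simp: Q_def)
      have "G n0 y \<subseteq> ?D"
        using \<open>f \<notin> Q y\<close> n Q_R R_part[of n0 y] by (auto simp: G_def)
      then have "movers \<subseteq> span ?D"
        using movers_span[of y] span_mono by blast
      moreover have "C n - movers \<subseteq> Q (Suc y)"
        using n by (auto simp: Q_def)
      then have "C n - movers \<subseteq> part n0 y"
        using Q_Suc_R R_part[of n0 y] by blast
      ultimately have "C n - {f} \<subseteq> span ?D"
        using span_superset[OF D_ground] by blast
      then have "f \<in> span ?D"
        using circuit_in_span[OF circuit n(3)] span_subset_span by blast
      moreover have "f \<in> part n0 y"
        using f Q_Suc_R R_part[of n0 y] by blast
      ultimately show False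
        using indep_not_in_span[OF indep_part] by blast
    qed
  qed
  then have Q_anti: "Q (y + k) \<subseteq> Q y" for y k
    by (induction k) (auto simp del: add_Suc_right simp: add_Suc_right[symmetric], auto)
  have Q_period: "Q (y * N) = Q 0" for y
    by (simp add: Q_def cong_def)
  have Q_0: "Q 0 \<subseteq> Q y" for y
  proof -
    have "y * N = y + y * (N - 1)"
      using N_pos by (cases N) auto
    then show ?thesis
      using Q_anti[of y "y * (N - 1)"] Q_period[of y] by simp
  qed
  have Q_eq: "Q y = Q 0" for y
    using Q_0[of y] Q_anti[of 0 y] by simp

  define H where "H = movers \<union> Q 0"
  have H_ground: "H \<subseteq> E"
    using movers_ground G_ground[of n0 0] by (auto simp: H_def G_def)
  have "rank H \<le> card (H \<inter> part n0 y)" for y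
  proof (rule rank_le_card_spanning)
    have eq: "G n0 y = H \<inter> part n0 y"
      using Q_eq[of y] Q_R[of y] R_part[of n0 y] by (auto simp: G_def H_def)
    show "indep (H \<inter> part n0 y)"
      using indep_part indep_subset by blast
    show "H \<subseteq> span (H \<inter> part n0 y)"
      using movers_span[of y] span_superset[OF G_ground[of n0 y]] Q_eq[of y]
      unfolding eq[symmetric] by (auto simp: H_def G_def)
  qed
  then have "N * rank H \<le> (\<Sum>y<N. card (H \<inter> part n0 y))"
    using sum_mono[of "{..<N}" "\<lambda>_. rank H" "\<lambda>y. card (H \<inter> part n0 y)"] by simp
  also have "\<dots> = sum (w(short n0 := w (short n0) - 1)) H"
    \<comment> \<open>The total weight in the parts is one less than \<open>sum w H\<close>, because
      \<open>short n0\<close> is a mover and so belongs to \<open>H\<close>.\<close>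
    unfolding part_def using weight_le_N H_ground N_pos
    by (intro sum_card_load) (auto intro: le_diff_conv[THEN iffD2] order_trans[OF diff_le_self])
  also have "\<dots> < sum w H"
    using short_mover[of n0] short_weight[of n0] H_ground finite_ground
    by (intro sum_strict_mono_ex1) (auto simp: H_def intro: finite_subset)
  also have "\<dots> \<le> N * rank H"
    using weight_le[OF H_ground] .
  finally show False by simp
qed

end

context matroid
begin

section \<open>The exchange step and the existence of assignments\<close>

lemma push_step:
  assumes N: "0 < N" and w_le: "\<And>e. e \<in> E \<Longrightarrow> w e \<le> N"
    and a: "a \<in> E" "0 < w a"
    and part: "\<And>y. indep (load N (w(a := w a - 1)) s y)"
    and dep: "\<not> indep (load N w s z0)"
  defines "z \<equiv> s a + (w a - 1)"
  obtains C b where "circuit C" "C \<subseteq> load N w s z" "b \<in> C" "[s b = z] (mod N)"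
    "\<And>e. e \<in> C \<Longrightarrow> [s e = z] (mod N) \<Longrightarrow> s b \<le> s e" "b \<in> E" "0 < w b"
    "\<And>y. indep (load N (w(b := w b - 1)) (s(b := Suc (s b))) y)"
proof -
  have part_eq: "load N (w(a := w a - 1)) s y =
      (if [y = z] (mod N) then load N w s y - {a} else load N w s y)" for y
    unfolding z_def by (rule load_shorten_right) (use a w_le in auto)
  have "[z0 = z] (mod N)"
    using part[of z0] dep part_eq[of z0] by (auto split: if_splits)
  then have dep_z: "\<not> indep (load N w s z)"
    using dep load_cong by metis
  have ground: "load N w s y \<subseteq> E" for y
    by (auto simp: load_def)
  obtain C where C: "circuit C" "C \<subseteq> load N w s z"
    using dependent_contains_circuit[OF ground dep_z] by metis
  \<comment> \<open>If no member started at \<open>z\<close>, all members would share the preceding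
    residue \<open>z + (N - 1)\<close>, even with \<open>a\<close> shortened, and there the load is
    independent.\<close>
  have "\<exists>b. b \<in> C \<and> [s b = z] (mod N)"
  proof (rule ccontr)
    assume no_start: "\<not> ?thesis"
    have "C \<subseteq> load N (w(a := w a - 1)) s (z + (N - 1))"
    proof
      fix e assume e: "e \<in> C"
      then obtain k where k: "e \<in> E" "k < w e" "[s e + k = z] (mod N)"
        using C by (auto simp: load_def)
      moreover have "k \<noteq> 0"
        using no_start e k(3) by (metis add_0_right)
      ultimately obtain j where j: "k = Suc j" "j < w e - 1"
        by (cases k) auto
      have "[s e + k + (N - 1) = z + (N - 1)] (mod N)"
        using k cong_add_rcancel_nat by blast
      moreover have "s e + k + (N - 1) = s e + j + N"
        using j N by simp
      ultimately have "[s e + j = z + (N - 1)] (mod N)"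
        unfolding cong_def by (metis mod_add_self2)
      then show "e \<in> load N (w(a := w a - 1)) s (z + (N - 1))"
        using j k by (auto simp: load_def intro!: exI[of _ j])
    qed
    then have "indep C"
      using part indep_subset by blast
    then show False
      using C by (simp add: circuit_def)
  qed
  then obtain b where b: "b \<in> C" "[s b = z] (mod N)"
    "\<And>e. e \<in> C \<Longrightarrow> [s e = z] (mod N) \<Longrightarrow> s b \<le> s e"
    using ex_has_least_nat[of "\<lambda>e. e \<in> C \<and> [s e = z] (mod N)" _ s] by blast
  have b_ground: "b \<in> E" "0 < w b"
    using b C by (auto simp: load_def)
  have "a \<in> load N w s z"
    using a by (auto simp: load_def z_def intro!: exI[of _ "w a - 1"])
  then have ins: "insert a (load N w s z - {a}) = load N w s z"
    by blast
  have "indep (load N w s z - {a})"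
    using part[of z] part_eq[of z] by simp
  then have exch: "indep (load N w s z - {b})"
    using circuit_exchange[of "load N w s z - {a}" C a b] C b ins by simp
  have "indep (load N (w(b := w b - 1)) (s(b := Suc (s b))) y)" for y
  proof (cases "[y = z] (mod N)")
    case True
    moreover from True have "load N w s y = load N w s z"
      by (rule load_cong)
    moreover have "[y = s b] (mod N)"
      using True b(2) cong_sym cong_trans by blast
    ultimately show ?thesis
      using exch load_shift[of w b N s y, OF b_ground(2) w_le[OF b_ground(1)]] by simp
  next
    case False
    then have "\<not> [y = s b] (mod N)"
      using b(2) cong_trans by blast
    then show ?thesis
      using False part[of y] part_eq[of y] load_shift[of w b N s y, OF b_ground(2) w_le[OF b_ground(1)]]
      by simp
  qed
  then show thesis
    using that C b b_ground by blast
qed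

text \<open>Induction on total length, which forces lengths to vary between elements. One unit is
  taken from some \<open>a\<close>; if no assignment for \<open>w\<close> existed, the exchanges
  starting from the shorter one would never end.\<close>

theorem weighted_cyclic_assignment:
  assumes N: "0 < N" and "\<And>A. A \<subseteq> E \<Longrightarrow> sum w A \<le> N * rank A"
  shows "\<exists>s. \<forall>y. indep (load N w s y)"
  using assms(2)
proof (induction "sum w E" arbitrary: w)
  case 0
  then have "load N w s y = {}" for s y
    using finite_ground by (auto simp: load_def)
  then show ?case
    using indep_empty by simp
next
  case (Suc m)
  have "sum w E \<noteq> 0"
    using Suc.hyps(2) by simp
  then obtain a where a: "a \<in> E" "0 < w a"
    using finite_ground by auto
  have "\<exists>s. \<forall>y. indep (load N (w(a := w a - 1)) s y)"
  proof (rule Suc.hyps(1))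
    have "sum (w(a := w a - 1)) (E - {a}) = sum w (E - {a})"
      by (rule sum.cong) auto
    then show "m = sum (w(a := w a - 1)) E"
      using Suc.hyps(2) a finite_ground by (simp add: sum.remove[of E a])
    fix A assume "A \<subseteq> E"
    moreover have "sum (w(a := w a - 1)) A \<le> sum w A"
      by (rule sum_mono) auto
    ultimately show "sum (w(a := w a - 1)) A \<le> N * rank A"
      using Suc.prems order_trans by blast
  qed
  then obtain s0 where s0: "\<And>y. indep (load N (w(a := w a - 1)) s0 y)"
    by blast
  have w_le: "w e \<le> N" if "e \<in> E" for e
    using Suc.prems[of "{e}"] that rank_singleton_le[of e]
    by (auto intro: order_trans[of _ "N * rank {e}"])
  show ?case
  proof (rule ccontr)
    assume "\<nexists>s. \<forall>y. indep (load N w s y)"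
    then have dep: "\<exists>z. \<not> indep (load N w s z)" for s
      by blast
    \<comment> \<open>States pair the start points with the short element. Every valid state has a
      successor, so dependent choice yields an infinite run.\<close>
    define valid where "valid = (\<lambda>(s, a). a \<in> E \<and> 0 < w a \<and>
      (\<forall>y. indep (load N (w(a := w a - 1)) s y)))"
    define step where "step = (\<lambda>(s, a) (t, b). \<exists>C. circuit C \<and>
      C \<subseteq> load N w s (s a + (w a - 1)) \<and> b \<in> C \<and> [s b = s a + (w a - 1)] (mod N) \<and>
      (\<forall>e \<in> C. [s e = s a + (w a - 1)] (mod N) \<longrightarrow> s b \<le> s e) \<and> t = s(b := Suc (s b)))"
    have step_ex: "\<exists>q. valid q \<and> step p q" if p: "valid p" for p
    proof -
      obtain s c where p_eq: "p = (s, c)" by (cases p)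
      have c: "c \<in> E" "0 < w c" "\<And>y. indep (load N (w(c := w c - 1)) s y)"
        using p by (auto simp: p_eq valid_def)
      obtain z where "\<not> indep (load N w s z)"
        using dep by blast
      from push_step[OF N w_le c this] obtain C b where
        "circuit C" "C \<subseteq> load N w s (s c + (w c - 1))" "b \<in> C" "[s b = s c + (w c - 1)] (mod N)"
        "\<And>e. e \<in> C \<Longrightarrow> [s e = s c + (w c - 1)] (mod N) \<Longrightarrow> s b \<le> s e" "b \<in> E" "0 < w b"
        "\<And>y. indep (load N (w(b := w b - 1)) (s(b := Suc (s b))) y)"
        by metis
      then have "valid (s(b := Suc (s b)), b) \<and> step p (s(b := Suc (s b)), b)"
        unfolding valid_def step_def p_eq by auto
      then show ?thesis by blast
    qed
    have "valid (s0, a)"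
      using a s0 by (simp add: valid_def)
    then obtain f where f: "\<And>n. valid (f n)" "\<And>n. step (f n) (f (Suc n))"
      using dependent_nat_choice[of "\<lambda>_. valid" "\<lambda>_. step"] step_ex by metis
    define start short where "start = (\<lambda>n. fst (f n))" and "short = (\<lambda>n. snd (f n))"
    have f_eq: "f n = (start n, short n)" for n
      by (simp add: start_def short_def)
    obtain C where C: "\<And>n. circuit (C n) \<and>
      C n \<subseteq> load N w (start n) (start n (short n) + (w (short n) - 1)) \<and> short (Suc n) \<in> C n \<and>
      [start n (short (Suc n)) = start n (short n) + (w (short n) - 1)] (mod N) \<and>
      (\<forall>e \<in> C n. [start n e = start n (short n) + (w (short n) - 1)] (mod N) \<longrightarrow>
        start n (short (Suc n)) \<le> start n e) \<and>
      start (Suc n) = (start n)(short (Suc n) := Suc (start n (short (Suc n))))"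
      using f(2) unfolding f_eq step_def by simp metis
    interpret push_sequence E indep N w start short C
    proof unfold_locales
      show "short n \<in> E" "0 < w (short n)"
        "indep (load N (w(short n := w (short n) - 1)) (start n) y)" for n y
        using f(1)[of n] by (auto simp: f_eq valid_def)
    qed (use C N Suc.prems in auto)
    show False
      by (rule push_sequence_impossible)
  qed
qed

end

section \<open>Arboricities\<close>

context matroid
begin

section \<open>Density of a loopless matroid\<close>

lemma rank_pos:
  assumes "loopless" "A \<subseteq> E" "A \<noteq> {}"
  shows "0 < rank A"
proof -
  obtain e where "e \<in> A" using assms by blast
  then have "card {e} \<le> rank A"
    using assms by (intro card_le_rank) (auto simp: loopless_def)
  then show ?thesis by simp
qed

lemma finite_densities:
  "finite {real (card A) / real (rank A) | A. A \<noteq> {} \<and> A \<subseteq> E}"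
proof -
  have "{real (card A) / real (rank A) | A. A \<noteq> {} \<and> A \<subseteq> E}
    \<subseteq> (\<lambda>A. real (card A) / real (rank A)) ` Pow E"
    by auto
  then show ?thesis
    using finite_ground by (meson finite_Pow_iff finite_imageI finite_subset)
qed

lemma max_density_le:
  assumes "loopless" "E \<noteq> {}" "\<And>A. A \<subseteq> E \<Longrightarrow> real (card A) \<le> d * real (rank A)"
  shows "max_density \<le> d"
proof -
  have "real (card A) / real (rank A) \<le> d" if "A \<noteq> {}" "A \<subseteq> E" for A
    using assms(3)[OF that(2)] rank_pos[OF assms(1) that(2,1)] by (simp add: divide_le_eq)
  then show ?thesis
    unfolding max_density_def using assms(2) by (subst Max_le_iff[OF finite_densities]) auto
qed

text \<open>A set attaining the maximum supplies \<open>p\<close> as its size and \<open>q\<close>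
  as its rank; \<open>q <= p\<close> later guarantees a circumference of at least 1.\<close>

lemma max_density_rational:
  assumes "loopless" "E \<noteq> {}"
  obtains p q :: nat where "0 < q" "q \<le> p" "max_density = real p / real q"
    "\<And>A. A \<subseteq> E \<Longrightarrow> q * card A \<le> p * rank A"
proof -
  have "max_density \<in> {real (card A) / real (rank A) | A. A \<noteq> {} \<and> A \<subseteq> E}"
    unfolding max_density_def using assms by (intro Max_in[OF finite_densities]) auto
  then obtain X where X: "X \<noteq> {}" "X \<subseteq> E" "max_density = real (card X) / real (rank X)"
    by auto
  have pos: "0 < rank X"
    using rank_pos[OF assms(1) X(2,1)] .
  show thesis
  proof (rule that[OF pos _ X(3)])
    show "rank X \<le> card X"
      using X finite_subset[OF X(2) finite_ground] by (intro rank_le card_mono) auto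
    fix A assume A: "A \<subseteq> E"
    show "rank X * card A \<le> card X * rank A"
    proof (cases "A = {}")
      case False
      have "real (card A) / real (rank A) \<le> real (card X) / real (rank X)"
        using X(3) A False unfolding max_density_def
        by (metis (mono_tags, lifting) Max_ge[OF finite_densities] mem_Collect_eq)
      then have "real (rank X * card A) \<le> real (card X * rank A)"
        using pos rank_pos[OF assms(1) A False] by (simp add: field_simps)
      then show ?thesis
        unfolding of_nat_le_iff .
    qed simp
  qed
qed

section \<open>Fractional arboricity\<close>

lemma bases_ground: "B \<in> bases \<Longrightarrow> B \<subseteq> E"
  by (auto simp: bases_def dest: indep_subset_ground)

lemma finite_bases: "finite bases"
  using bases_ground finite_ground by (auto intro: finite_subset[of _ "Pow E"])

lemma indep_subset_basis:
  assumes "indep I"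
  obtains B where "B \<in> bases" "I \<subseteq> B"
proof -
  obtain B where B: "indep B" "I \<subseteq> B" "B \<subseteq> E" "\<And>e. e \<in> E \<Longrightarrow> indep (insert e B) \<Longrightarrow> e \<in> B"
    using extend_maximal[OF assms indep_subset_ground[OF assms]] by metis
  have "K = B" if "indep K" "B \<subseteq> K" for K
  proof -
    have "e \<in> B" if "e \<in> K" for e
      using B(4)[of e] that \<open>indep K\<close> \<open>B \<subseteq> K\<close> indep_subset[of K "insert e B"] indep_subset_ground[of K]
      by auto
    then show ?thesis using that by blast
  qed
  then show thesis
    using that[of B] B by (auto simp: bases_def)
qed

text \<open>Weak duality: weighted counting of incidences, where a basis meets \<open>A\<close> in
  at most \<open>rank A\<close> elements.\<close>

lemma card_le_fractional_cover:
  fixes x :: "'a set \<Rightarrow> real"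
  assumes nonneg: "\<And>B. B \<in> bases \<Longrightarrow> 0 \<le> x B"
    and cover: "\<And>e. e \<in> E \<Longrightarrow> 1 \<le> (\<Sum>B \<in> {B \<in> bases. e \<in> B}. x B)"
    and "A \<subseteq> E"
  shows "real (card A) \<le> (\<Sum>B\<in>bases. x B) * real (rank A)"
proof -
  have fin: "finite A"
    using assms(3) finite_ground finite_subset by blast
  have "real (card A) = (\<Sum>e\<in>A. 1)"
    by simp
  also have "\<dots> \<le> (\<Sum>e\<in>A. \<Sum>B \<in> {B \<in> bases. e \<in> B}. x B)"
    using assms by (intro sum_mono) auto
  also have "\<dots> = (\<Sum>B\<in>bases. \<Sum>e \<in> {e \<in> A. e \<in> B}. x B)"
    by (rule sum.swap_restrict[OF fin finite_bases])
  also have "\<dots> = (\<Sum>B\<in>bases. x B * real (card {e \<in> A. e \<in> B}))"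
    by (simp add: mult.commute)
  also have "\<dots> \<le> (\<Sum>B\<in>bases. x B * real (rank A))"
  proof (intro sum_mono mult_left_mono)
    fix B assume B: "B \<in> bases"
    have "card {e \<in> A. e \<in> B} \<le> rank A"
      using B by (intro card_le_rank) (auto simp: bases_def intro: indep_subset)
    then show "real (card {e \<in> A. e \<in> B}) \<le> real (rank A)" by simp
  qed (use nonneg in auto)
  finally show ?thesis
    by (simp add: sum_distrib_right)
qed

text \<open>With all lengths \<open>q\<close> on \<open>p\<close> residues, each element lies in
  \<open>q\<close> of the \<open>p\<close> independent loads; these extend to bases of weight
  \<open>1 / q\<close> each.\<close>

lemma fractional_cover_of_density:
  assumes "0 < q" "0 < p" "\<And>A. A \<subseteq> E \<Longrightarrow> q * card A \<le> p * rank A"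
  obtains x :: "'a set \<Rightarrow> real" where "\<And>B. 0 \<le> x B"
    "\<And>e. e \<in> E \<Longrightarrow> 1 \<le> (\<Sum>B \<in> {B \<in> bases. e \<in> B}. x B)"
    "(\<Sum>B\<in>bases. x B) = real p / real q"
proof -
  have "sum (\<lambda>_. q) A \<le> p * rank A" if "A \<subseteq> E" for A
    using assms(3)[OF that] by (simp add: mult.commute)
  then obtain s where s: "\<And>y. indep (load p (\<lambda>_. q) s y)"
    using weighted_cyclic_assignment[OF assms(2)] by blast
  have "\<exists>B. B \<in> bases \<and> load p (\<lambda>_. q) s y \<subseteq> B" for y
    using indep_subset_basis[OF s] by metis
  then obtain b where b: "\<And>y. b y \<in> bases" "\<And>y. load p (\<lambda>_. q) s y \<subseteq> b y"
    by metis
  \<comment> \<open>Different residues may yield the same basis, so weights add up over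
    \<open>y\<close>.\<close>
  define x :: "'a set \<Rightarrow> real" where "x B = (\<Sum>y<p. of_bool (b y = B)) / real q" for B
  have sum_x: "(\<Sum>B\<in>\<B>. x B) = (\<Sum>y<p. of_bool (b y \<in> \<B>)) / real q" if "\<B> \<subseteq> bases" for \<B>
  proof -
    have fin: "finite \<B>"
      using that finite_bases finite_subset by blast
    have "(\<Sum>B\<in>\<B>. x B) = (\<Sum>y<p. \<Sum>B\<in>\<B>. of_bool (b y = B)) / real q"
      unfolding x_def sum_divide_distrib[symmetric] by (subst sum.swap) simp
    also have "(\<Sum>y<p. \<Sum>B\<in>\<B>. of_bool (b y = B)) = (\<Sum>y<p. of_bool (b y \<in> \<B>) :: real)"
      using fin by (intro sum.cong) (auto simp: of_bool_def)
    finally show ?thesis .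
  qed
  show thesis
  proof (rule that[of x])
    show "0 \<le> x B" for B
      by (simp add: x_def sum_nonneg)
    show "(\<Sum>B\<in>bases. x B) = real p / real q"
      by (simp add: sum_x b)
    fix e assume e: "e \<in> E"
    have "q \<le> p"
      using assms(3)[of "{e}"] e rank_singleton_le[of e]
      by (auto intro: order_trans[of _ "p * rank {e}"])
    then have "real q = real (\<Sum>y<p. card ({e} \<inter> load p (\<lambda>_. q) s y))"
      using e assms by (subst sum_card_load) auto
    also have "\<dots> \<le> (\<Sum>y<p. of_bool (b y \<in> {B \<in> bases. e \<in> B}))"
      unfolding of_nat_sum using b by (intro sum_mono) (auto simp: Int_insert_left)
    finally show "1 \<le> (\<Sum>B \<in> {B \<in> bases. e \<in> B}. x B)"
      using assms(1) by (simp add: sum_x le_divide_eq)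
  qed
qed

lemma fractional_arboricity_eq:
  assumes "loopless" "E \<noteq> {}"
  shows "fractional_arboricity = max_density"
  unfolding fractional_arboricity_def
proof (rule Least_equality)
  obtain p q where pq: "0 < q" "q \<le> p" "max_density = real p / real q"
    "\<And>A. A \<subseteq> E \<Longrightarrow> q * card A \<le> p * rank A"
    using max_density_rational[OF assms] by metis
  have "0 < p" using pq by simp
  then show "\<exists>x :: 'a set \<Rightarrow> real. (\<forall>B\<in>bases. 0 \<le> x B) \<and>
    (\<forall>e\<in>E. 1 \<le> (\<Sum>B \<in> {B \<in> bases. e \<in> B}. x B)) \<and> max_density = (\<Sum>B\<in>bases. x B)"
    using fractional_cover_of_density[OF pq(1) _ pq(4)] pq(3) by metis
next
  fix v assume "\<exists>x :: 'a set \<Rightarrow> real. (\<forall>B\<in>bases. 0 \<le> x B) \<and>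
    (\<forall>e\<in>E. 1 \<le> (\<Sum>B \<in> {B \<in> bases. e \<in> B}. x B)) \<and> v = (\<Sum>B\<in>bases. x B)"
  then show "max_density \<le> v"
    using card_le_fractional_cover by (intro max_density_le[OF assms]) blast
qed

section \<open>Circular arboricity\<close>

lemma circular_map_of_density:
  assumes "0 < q" "0 < p" "\<And>A. A \<subseteq> E \<Longrightarrow> q * card A \<le> p * rank A"
  defines "d \<equiv> real p / real q"
  shows "\<exists>\<phi> \<in> E \<rightarrow> circle d. \<forall>x \<in> circle d. indep {e \<in> E. \<phi> e \<in> cyclic_interval d x}"
proof -
  have "sum (\<lambda>_. q) A \<le> p * rank A" if "A \<subseteq> E" for A
    using assms(3)[OF that] by (simp add: mult.commute)
  then obtain s where s: "\<And>y. indep (load p (\<lambda>_. q) s y)"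
    using weighted_cyclic_assignment[OF assms(2)] by blast
  define \<phi> where "\<phi> e = circle_point d (real (s e) / real q)" for e
  have "indep {e \<in> E. \<phi> e \<in> cyclic_interval d (circle_point d t)}" for t
  proof -
    \<comment> \<open>The last of the \<open>q\<close> integers in the window scaled by
      \<open>q\<close>. Any lift \<open>i\<close> of a start point in that window satisfies
      \<open>m - q < i\<close> and \<open>i <= m\<close>, so all these intervals contain
      \<open>m\<close>.\<close>
    define m where "m = \<lceil>real q * t\<rceil> + int q - 1"
    have "{e \<in> E. \<phi> e \<in> cyclic_interval d (circle_point d t)} \<subseteq> load p (\<lambda>_. q) s (nat (m mod int p))"
    proof
      fix e assume e: "e \<in> {e \<in> E. \<phi> e \<in> cyclic_interval d (circle_point d t)}"
      then obtain u where u: "t \<le> u" "u < t + 1" "[real (s e) / real q = u] (rmod d)"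
        unfolding cyclic_interval_circle_point \<phi>_def by (auto simp: circle_point_eq_iff)
      then obtain n where "u = real (s e) / real q + of_int n * d"
        unfolding rcong_altdef by blast
      then have qu: "real q * u = of_int (int (s e) + n * int p)"
        using assms(1) by (simp add: d_def field_simps)
      define i where "i = int (s e) + n * int p"
      have "real q * t \<le> of_int i"
        using u assms(1) unfolding i_def qu[symmetric] by simp
      then have ge: "\<lceil>real q * t\<rceil> \<le> i"
        by (simp add: ceiling_le_iff)
      have "of_int i < real q * (t + 1)"
        using u assms(1) unfolding i_def qu[symmetric] by simp
      then have "of_int (i - int q) < real q * t"
        by (simp add: algebra_simps)
      then have lt: "i - int q < \<lceil>real q * t\<rceil>"
        by (simp add: less_ceiling_iff)
      define k where "k = nat (m - i)"
      have k: "int k = m - i" "k < q"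
        using ge lt by (auto simp: k_def m_def)
      have "int (s e + k) = m + (- n) * int p"
        using k by (simp add: i_def)
      then have "int (s e + k) mod int p = m mod int p"
        by (metis mod_mult_self1)
      then have "int ((s e + k) mod p) = int (nat (m mod int p) mod p)"
        using assms(2) by (simp add: zmod_int)
      then have "[s e + k = nat (m mod int p)] (mod p)"
        unfolding cong_def by linarith
      then show "e \<in> load p (\<lambda>_. q) s (nat (m mod int p))"
        using k e by (auto simp: load_def)
    qed
    then show ?thesis
      using s indep_subset by blast
  qed
  moreover have "\<phi> \<in> E \<rightarrow> circle d"
    by (auto simp: \<phi>_def circle_eq_range)
  ultimately show ?thesis
    by (intro bexI[of _ \<phi>]) (auto simp: circle_eq_range)
qed

text \<open>Averages, over all \<open>t\<close>, the number of elements of \<open>A\<close> in the window at \<open>t\<close>: each element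
  lies in the windows of a set of \<open>t\<close> of measure \<open>1\<close>.\<close>

lemma card_le_circular:
  assumes d: "1 \<le> d" and \<phi>: "\<phi> \<in> E \<rightarrow> circle d"
    and windows: "\<And>x. x \<in> circle d \<Longrightarrow> indep {e \<in> E. \<phi> e \<in> cyclic_interval d x}"
    and A: "A \<subseteq> E"
  shows "real (card A) \<le> d * real (rank A)"
proof -
  have "\<exists>u. 0 \<le> u \<and> u < d \<and> \<phi> e = circle_point d u" if e: "e \<in> E" for e
  proof -
    obtain v where "\<phi> e = circle_point d v"
      using \<phi> e unfolding circle_eq_range by blast
    then show ?thesis
      using d rmod_less[of d v] rmod_nonneg[of d v]
      by (intro exI[of _ "v rmod d"]) (auto simp: circle_point_eq_iff)
  qed
  then obtain u where u: "\<And>e. e \<in> E \<Longrightarrow> 0 \<le> u e" "\<And>e. e \<in> E \<Longrightarrow> u e < d"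
    "\<And>e. e \<in> E \<Longrightarrow> \<phi> e = circle_point d (u e)"
    by metis
  have fin: "finite A"
    using A finite_ground finite_subset by blast
  \<comment> \<open>Window starts in the fundamental domain that see \<open>e\<close> directly
    (\<open>L\<close>) or across the wrap-around (\<open>R\<close>). If \<open>u e < 1\<close> the
    lengths are \<open>u e\<close> and \<open>1 - u e\<close>; otherwise \<open>L\<close> has length
    1 and \<open>R\<close> is empty. Omitting the left end points only loses a null set.\<close>
  define L where "L e = {max 0 (u e - 1)<..u e}" for e
  define R where "R e = {u e + d - 1<..<d}" for e
  define h :: "'a \<Rightarrow> real \<Rightarrow> real" where "h e t = indicator (L e) t + indicator (R e) t" for e t
  have "has_bochner_integral lborel (h e) 1" if e: "e \<in> A" for e
  proof -
    have "measure lborel (L e) + measure lborel (R e) = 1"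
      using u e A d by (auto simp: L_def R_def max_def)
    moreover have "has_bochner_integral lborel (h e) (measure lborel (L e) + measure lborel (R e))"
      unfolding h_def L_def R_def
      by (intro has_bochner_integral_add has_bochner_integral_real_indicator emeasure_bounded_finite) auto
    ultimately show ?thesis by simp
  qed
  then have int_h: "has_bochner_integral lborel (\<lambda>t. \<Sum>e\<in>A. h e t) (\<Sum>e\<in>A. 1)"
    by (rule has_bochner_integral_sum)
  have int_bound: "has_bochner_integral lborel (\<lambda>t. indicator {0..<d} t *\<^sub>R real (rank A))
    (measure lborel {0..<d} *\<^sub>R real (rank A))"
    by (intro has_bochner_integral_scaleR_left has_bochner_integral_real_indicator emeasure_bounded_finite) auto
  have "(\<Sum>e\<in>A. h e t) \<le> indicator {0..<d} t *\<^sub>R real (rank A)" for t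
  proof (cases "t \<in> {0..<d}")
    case True
    let ?S = "{e \<in> A. \<phi> e \<in> cyclic_interval d (circle_point d t)}"
    have "h e t \<le> indicator ?S e" if e: "e \<in> A" for e
    proof -
      have "e \<in> ?S" if "t \<in> L e"
        using that e A u(3)[of e] unfolding cyclic_interval_circle_point by (auto simp: L_def)
      moreover have "e \<in> ?S" if "t \<in> R e"
      proof -
        have "[u e = u e + d] (rmod d)"
          unfolding rcong_altdef by (intro exI[of _ 1]) simp
        then have "\<phi> e = circle_point d (u e + d)"
          using u(3)[of e] e A circle_point_eq_iff by (metis subsetD)
        moreover have "u e + d \<in> {t..<t + 1}"
          using that u(1)[of e] e A by (auto simp: R_def)
        ultimately show ?thesis
          using e unfolding cyclic_interval_circle_point by blast
      qed
      \<comment> \<open>A circumference of at least 1 keeps a window from counting \<open>e\<close>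
        twice.\<close>
      moreover have "\<not> (t \<in> L e \<and> t \<in> R e)"
        using d by (auto simp: L_def R_def)
      ultimately show ?thesis
        by (auto simp: h_def indicator_def)
    qed
    then have "(\<Sum>e\<in>A. h e t) \<le> (\<Sum>e\<in>A. indicator ?S e)"
      by (rule sum_mono)
    also have "\<dots> = real (card ?S)"
      using fin by (simp add: indicator_def sum.If_cases Int_def)
    also have "\<dots> \<le> real (rank A)"
    proof -
      have "indep {e \<in> E. \<phi> e \<in> cyclic_interval d (circle_point d t)}"
        by (rule windows) (simp add: circle_eq_range)
      then have "indep ?S"
        using A by (auto intro: indep_subset)
      then show ?thesis
        using card_le_rank[of ?S A] by auto
    qed
    finally show ?thesis
      using True by simp
  next
    case False
    have "h e t = 0" if "e \<in> A" for e
      using False u(1,2)[of e] that A d by (auto simp: h_def L_def R_def indicator_def)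
    then show ?thesis
      using False by simp
  qed
  then have "integral\<^sup>L lborel (\<lambda>t. \<Sum>e\<in>A. h e t)
    \<le> integral\<^sup>L lborel (\<lambda>t. indicator {0..<d} t *\<^sub>R real (rank A))"
    by (rule integral_mono[OF integrable.intros[OF int_h] integrable.intros[OF int_bound]])
  then have "(\<Sum>e\<in>A. 1) \<le> measure lborel {0..<d} *\<^sub>R real (rank A)"
    unfolding has_bochner_integral_integral_eq[OF int_h] has_bochner_integral_integral_eq[OF int_bound] .
  then show ?thesis
    using d by simp
qed

lemma circular_arboricity_eq:
  assumes "loopless" "E \<noteq> {}"
  shows "circular_arboricity = max_density"
  unfolding circular_arboricity_def
proof (rule cInf_eq_minimum)
  obtain p q where pq: "0 < q" "q \<le> p" "max_density = real p / real q"
    "\<And>A. A \<subseteq> E \<Longrightarrow> q * card A \<le> p * rank A"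
    using max_density_rational[OF assms] by metis
  then show "max_density \<in> {d. 1 \<le> d \<and> (\<exists>\<phi> \<in> E \<rightarrow> circle d.
      \<forall>x \<in> circle d. indep {e \<in> E. \<phi> e \<in> cyclic_interval d x})}"
    using circular_map_of_density[of q p] by (simp add: le_divide_eq)
next
  fix d assume "d \<in> {d. 1 \<le> d \<and> (\<exists>\<phi> \<in> E \<rightarrow> circle d.
      \<forall>x \<in> circle d. indep {e \<in> E. \<phi> e \<in> cyclic_interval d x})}"
  then show "max_density \<le> d"
    using card_le_circular by (intro max_density_le[OF assms]) blast
qed

end

theorem theorem1p9:
  fixes E :: "'a set" and indep :: "'a set \<Rightarrow> bool"
  assumes "matroid E indep"
    and "matroid.loopless E indep"
    and "E \<noteq> {}"
  shows "matroid.circular_arboricity E indep = matroid.fractional_arboricity E indep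
       \<and> matroid.fractional_arboricity E indep = matroid.max_density E indep"
  using matroid.circular_arboricity_eq[OF assms] matroid.fractional_arboricity_eq[OF assms] by simp

end
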